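(* Let $r\geq 2$ and $k\geq 2$ be integers, let $d=rk$, and let $f:\overline{\mathbb{C}}\to\overline{\mathbb{C}}$ be a rational map of degree $d$ with exactly $3$ branching points, whose branching datum is $$\{\mu_1=[\alpha_1,\ldots,\alpha_A],\ \mu_2=[rx_1,\ldots,rx_B],\ \mu_3=[ry_1,\ldots,ry_C]\},$$ where the $\alpha_i$, $x_i$, $y_i$ are positive integers. Then $\alpha_j\leq k$ for every $j=1,\ldots,A$.
   Context: $\overline{\mathbb{C}}=\mathbb{C}\cup\{\infty\}$ is the Riemann sphere. Square brackets denote unordered lists with repetitions (multisets). For a non-constant rational map $h:\overline{\mathbb{C}}\to\overline{\mathbb{C}}$ of degree $d$ and $x\in\overline{\mathbb{C}}$, let $\mu(x)$ be the partition of $d$ formed by the local degrees (multiplicities) of $h$ at the points of $h^{-1}(x)$. The branching points of $h$ are the points $x$ of the target for which $\mu(x)$ is not the trivial partition $[1,\ldots,1]$, and the branching datum of $h$ is the collection (with repetitions) of the partitions $\mu(x)$ over all branching points $x$. *)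

theory Defs
  imports
    "HOL-Complex_Analysis.Complex_Analysis"
    "HOL-Computational_Algebra.Computational_Algebra"
    "HOL-Library.Multiset"
begin

datatype riemann_sphere = Fin complex | Infty

(* The map z |-> p(z)/q(z).  With n = max (degree p) (degree q), its value at infinity is the
   quotient of the n-th coefficients.  It is meaningful only if p and q are coprime; the case
   q = 0, p a nonzero constant is the constant map with value infinity. *)
fun ratmap :: "complex poly \<Rightarrow> complex poly \<Rightarrow> riemann_sphere \<Rightarrow> riemann_sphere" where
  "ratmap p q (Fin z) = (if poly q z = 0 then Infty else Fin (poly p z / poly q z))"
| "ratmap p q Infty =
     (let n = max (degree p) (degree q)
      in if coeff q n = 0 then Infty else Fin (coeff p n / coeff q n))"

definition rational_map_of_degree :: "(riemann_sphere \<Rightarrow> riemann_sphere) \<Rightarrow> nat \<Rightarrow> bool" where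
  "rational_map_of_degree h d \<longleftrightarrow>
     (\<exists>p q. coprime p q \<and> h = ratmap p q \<and> d = max (degree p) (degree q))"

(* The inverse of the standard chart centred at a point: t = 0 is sent to that point. *)
fun param :: "riemann_sphere \<Rightarrow> complex \<Rightarrow> riemann_sphere" where
  "param (Fin a) t = Fin (a + t)"
| "param Infty t = (if t = 0 then Infty else Fin (1 / t))"

(* The standard chart centred at the first argument, which it sends to 0.  Its value at the one
   point outside the domain of the chart (Infty, respectively Fin 0) is a dummy. *)
fun chart :: "riemann_sphere \<Rightarrow> riemann_sphere \<Rightarrow> complex" where
  "chart (Fin w) (Fin z) = z - w"
| "chart (Fin w) Infty = 0"
| "chart Infty (Fin z) = 1 / z"
| "chart Infty Infty = 0"

(* The order of vanishing at 0 of h read in charts centred at x and h x.  Since zorder only looks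
   at a punctured neighbourhood of 0, the dummy values of chart play no role when h is a
   non-constant rational map. *)
definition local_degree :: "(riemann_sphere \<Rightarrow> riemann_sphere) \<Rightarrow> riemann_sphere \<Rightarrow> nat" where
  "local_degree h x = nat (zorder (\<lambda>t. chart (h x) (h (param x t))) 0)"

(* The fibres of a non-constant rational map are finite, as mset_set requires. *)
definition fibre_partition ::
    "(riemann_sphere \<Rightarrow> riemann_sphere) \<Rightarrow> riemann_sphere \<Rightarrow> nat multiset" where
  "fibre_partition h x = image_mset (local_degree h) (mset_set (h -` {x}))"

definition branching_points ::
    "nat \<Rightarrow> (riemann_sphere \<Rightarrow> riemann_sphere) \<Rightarrow> riemann_sphere set" where
  "branching_points d h = {x. fibre_partition h x \<noteq> replicate_mset d 1}"

definition branching_datum ::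
    "nat \<Rightarrow> (riemann_sphere \<Rightarrow> riemann_sphere) \<Rightarrow> nat multiset multiset" where
  "branching_datum d h = image_mset (fibre_partition h) (mset_set (branching_points d h))"

end

theory Submission
  imports Defs
begin

text \<open>
  A rational map whose local degrees over two points \<open>v \<noteq> w\<close> are all divisible by \<open>r\<close> is, up to a
  Moebius change of the target sending \<open>v\<close>, \<open>w\<close> to \<open>0\<close>, \<open>\<infinity>\<close>, an \<open>r\<close>-th power \<open>g ^ r\<close> with \<open>g\<close> of
  degree \<open>k = d / r\<close>.  Away from \<open>0\<close> and \<open>\<infinity>\<close> the map \<open>\<zeta> \<mapsto> \<zeta> ^ r\<close> is unramified, so over any other
  point the local degrees are local degrees of \<open>g\<close>, hence at most \<open>k\<close>.

  The proof carries this out with polynomials.  Write the map as \<open>p / q\<close>.  The fibre over a target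
  point is the zero divisor of one member of the pencil spanned by \<open>p\<close> and \<open>q\<close>, seen as a binary
  form of degree \<open>d\<close>: \<open>p - c q\<close> for the point \<open>c\<close>, and \<open>q\<close> for the point at infinity.  Local degrees
  are root orders, and the defect \<open>d - degree\<close> at infinity (\<open>local_degree_Fin\<close>,
  \<open>local_degree_Infty\<close>).  Over \<open>v\<close> and \<open>w\<close> these forms are, up to constants, powers \<open>G ^ r\<close> and
  \<open>H ^ r\<close>, and every third member \<open>P\<close> of the pencil is a combination \<open>s G ^ r + t H ^ r\<close> with \<open>s\<close>,
  \<open>t\<close> nonzero (\<open>fibre_poly_combination\<close>).  At a given zero of \<open>P\<close>, choosing \<open>c\<close> to be the value of
  \<open>G / H\<close> there gives
  \<open>P = s (G ^ r - (c H) ^ r) = s (G - c H) Q\<close> with \<open>Q = (\<Sum>i<r. G ^ i (c H) ^ (r - 1 - i))\<close>,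
  and \<open>Q\<close> takes the value \<open>r G ^ (r - 1) \<noteq> 0\<close> at that zero.  So the zero has the same order in \<open>P\<close> as
  in \<open>G - c H\<close>, a form of degree \<open>k\<close>.
\<close>

section \<open>Polynomials\<close>

text \<open>
  The coefficient at a degree bound \<open>n\<close> is the value at infinity of a polynomial read as a binary
  form of degree \<open>n\<close>; the next two lemmas say that this value is multiplicative.
\<close>
lemma coeff_mult_degree_bounds:
  fixes p q :: "'a::comm_semiring_0 poly"
  assumes "degree p \<le> m" "degree q \<le> n"
  shows "coeff (p * q) (m + n) = coeff p m * coeff q n"
proof (cases "degree p = m \<and> degree q = n")
  case True
  then show ?thesis by (metis coeff_mult_degree_sum)
next
  case False
  with assms have "degree p < m \<or> degree q < n" by linarith
  moreover from this have "degree (p * q) < m + n"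
    using assms degree_mult_le[of p q] by linarith
  ultimately show ?thesis by (auto simp: coeff_eq_0)
qed

lemma coeff_power_degree_bound:
  fixes p :: "'a::comm_semiring_1 poly"
  assumes "degree p \<le> m"
  shows "coeff (p ^ n) (n * m) = coeff p m ^ n"
proof (induction n)
  case (Suc n)
  have "degree (p ^ n) \<le> n * m"
    using degree_power_le[of p n] assms
    by (metis le_trans mult.commute mult_le_mono1)
  from coeff_mult_degree_bounds[OF assms this] Suc show ?case by simp
qed simp

text \<open>
  Over the complex numbers a polynomial is determined by its leading coefficient and its root
  orders, so the orders can simply be divided by \<open>r\<close>.
\<close>
lemma power_factor_if_root_orders_divisible:
  fixes P :: "complex poly"
  assumes "P \<noteq> 0" and "\<And>z. poly P z = 0 \<Longrightarrow> r dvd order z P"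
  obtains a G where "a \<noteq> 0" "P = smult a (G ^ r)"
proof
  show "lead_coeff P \<noteq> 0" using assms(1) by simp
  have "P = smult (lead_coeff P) (\<Prod>z | poly P z = 0. [:- z, 1:] ^ order z P)"
    by (simp add: complex_poly_decompose)
  also have "(\<Prod>z | poly P z = 0. [:- z, 1:] ^ order z P)
      = (\<Prod>z | poly P z = 0. [:- z, 1:] ^ (order z P div r)) ^ r"
    unfolding prod_power_distrib
    by (rule prod.cong) (simp_all add: assms(2) flip: power_mult)
  finally show "P = smult (lead_coeff P) ((\<Prod>z | poly P z = 0. [:- z, 1:] ^ (order z P div r)) ^ r)" .
qed

text \<open>
  Where \<open>G\<close> and \<open>H\<close> agree, all \<open>r\<close> summands of the cofactor of \<open>G - H\<close> in \<open>G ^ r - H ^ r\<close> agree too.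
  If the common value is nonzero, the cofactor therefore does not vanish there, and all zeros of
  \<open>G ^ r - H ^ r\<close> at this place come from \<open>G - H\<close>.  The last conclusion is the same fact at infinity.
\<close>
lemma diff_powers_cofactor:
  fixes G H :: "complex poly"
  assumes "degree G \<le> k" "degree H \<le> k" "0 < r"
  obtains Q where "G ^ r - H ^ r = (G - H) * Q"
    and "\<And>z. poly G z = poly H z \<Longrightarrow> poly Q z = of_nat r * poly G z ^ (r - 1)"
    and "coeff G k = coeff H k \<Longrightarrow> coeff Q ((r - 1) * k) = of_nat r * coeff G k ^ (r - 1)"
proof -
  obtain n where r: "r = Suc n" using assms(3) by (cases r) auto
  define Q where "Q = (\<Sum>i<Suc n. G ^ i * H ^ (n - i))"
  show thesis
  proof
    show "G ^ r - H ^ r = (G - H) * Q"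
      unfolding r Q_def by (rule diff_power_eq_sum)
    show "poly Q z = of_nat r * poly G z ^ (r - 1)" if "poly G z = poly H z" for z
    proof -
      have "poly Q z = (\<Sum>i<Suc n. poly G z ^ n)"
        unfolding Q_def poly_sum
        by (rule sum.cong) (auto simp: that simp flip: power_add)
      then show ?thesis by (simp add: r)
    qed
    show "coeff Q ((r - 1) * k) = of_nat r * coeff G k ^ (r - 1)" if "coeff G k = coeff H k"
    proof -
      have "coeff (G ^ i * H ^ (n - i)) (n * k) = coeff G k ^ n" if "i < Suc n" for i
      proof -
        have "degree (G ^ i) \<le> i * k" "degree (H ^ (n - i)) \<le> (n - i) * k"
          using degree_power_le[of G i] degree_power_le[of H "n - i"] assms
          by (metis le_trans mult.commute mult_le_mono1)+
        from coeff_mult_degree_bounds[OF this]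
        have "coeff (G ^ i * H ^ (n - i)) (i * k + (n - i) * k) = coeff G k ^ i * coeff G k ^ (n - i)"
          by (simp add: coeff_power_degree_bound assms \<open>coeff G k = coeff H k\<close>)
        moreover have "i * k + (n - i) * k = n * k"
          using that by (simp flip: add_mult_distrib)
        ultimately show ?thesis using that by (simp flip: power_add)
      qed
      then have "coeff Q (n * k) = (\<Sum>i<Suc n. coeff G k ^ n)"
        unfolding Q_def coeff_sum by (intro sum.cong) auto
      then show ?thesis by (simp add: r)
    qed
  qed
qed

section \<open>Fibre polynomials and local degrees\<close>

text \<open>
  Read as a binary form of degree \<open>max (degree p) (degree q)\<close>, this polynomial has the fibre of
  \<open>ratmap p q\<close> over the given point as its zero divisor, infinity included.
\<close>
fun fibre_poly :: "complex poly \<Rightarrow> complex poly \<Rightarrow> riemann_sphere \<Rightarrow> complex poly" where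
  "fibre_poly p q (Fin c) = p - smult c q"
| "fibre_poly p q Infty = q"

text \<open>
  The coordinates of a fibre polynomial with respect to \<open>p\<close> and \<open>q\<close> are \<open>(1, - c)\<close> or \<open>(0, 1)\<close>.
  Distinct points give linearly independent coordinate vectors, and in the plane each of three
  pairwise independent vectors is a combination of the other two with nonzero coefficients.
\<close>
lemma fibre_poly_combination:
  assumes "u \<noteq> v" "u \<noteq> w" "v \<noteq> w"
  obtains s t where "s \<noteq> 0" "t \<noteq> 0"
    "fibre_poly p q u = smult s (fibre_poly p q v) + smult t (fibre_poly p q w)"
proof (cases u)
  case u: (Fin a)
  show thesis
  proof (cases v)
    case v: (Fin b)
    show thesis
    proof (cases w)
      case w: (Fin c)
      have ne: "b - c \<noteq> 0" using assms v w by auto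
      define s t where "s = (a - c) / (b - c)" and "t = (b - a) / (b - c)"
      have st: "s + t = 1" "s * b + t * c = a"
        using ne by (simp_all add: s_def t_def divide_simps) (simp_all add: algebra_simps)
      have "fibre_poly p q u = smult (s + t) p - smult (s * b + t * c) q"
        unfolding st by (simp add: u)
      also have "\<dots> = smult s (fibre_poly p q v) + smult t (fibre_poly p q w)"
        by (simp add: v w smult_add_left smult_diff_right)
      finally show thesis
        using that[of s t] assms ne u v w by (auto simp: s_def t_def)
    next
      case w: Infty
      show thesis
        using that[of 1 "b - a"] assms by (auto simp: u v w smult_diff_left)
    qed
  next
    case v: Infty
    then obtain c where w: "w = Fin c" using assms by (cases w) auto
    show thesis
      using that[of "c - a" 1] assms by (auto simp: u v w smult_diff_left)
  qed
next
  case u: Infty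
  then obtain b c where vw: "v = Fin b" "w = Fin c" using assms by (cases v; cases w) auto
  then have ne: "c - b \<noteq> 0" using assms by auto
  have "smult (1 / (c - b)) (p - smult b q) + smult (- 1 / (c - b)) (p - smult c q)
      = smult (1 / (c - b) * (c - b)) q"
    by (simp only: smult_diff_right smult_smult flip: smult_minus_left)
       (simp add: poly_eq_iff field_simps)
  then show thesis
    using that[of "1 / (c - b)" "- 1 / (c - b)"] ne by (simp add: u vw)
qed

lemma zorder_quotient_of_polys:
  assumes "\<forall>\<^sub>F t in at 0. h t = t ^ n * poly U t / poly V t" "poly U 0 \<noteq> 0" "poly V 0 \<noteq> 0"
  shows "zorder h 0 = int n"
proof -
  have "zorder h 0 = zorder (\<lambda>t. t ^ n * poly U t / poly V t) 0"
    by (rule zorder_cong) (use assms(1) in auto)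
  also have "\<dots> = int n"
  proof (rule zorder_eqI)
    show "open {t. poly V t \<noteq> 0}"
      by (rule open_Collect_neq) (auto intro!: continuous_intros)
    show "(\<lambda>t. poly U t / poly V t) holomorphic_on {t. poly V t \<noteq> 0}"
      by (auto intro!: holomorphic_intros)
  qed (use assms in auto)
  finally show ?thesis .
qed

locale nonconstant_ratmap =
  fixes p q :: "complex poly" and d :: nat
  assumes coprime: "coprime p q" and degree_eq: "d = max (degree p) (degree q)"
    and nonconstant: "0 < d"
begin

lemma no_common_root: "poly p z \<noteq> 0 \<or> poly q z \<noteq> 0"
  using coprime coprime_poly_0 by blast

lemma degree_fibre_poly_le: "degree (fibre_poly p q w) \<le> d"
  by (cases w) (auto simp: degree_eq intro!: degree_diff_le order.trans[OF degree_smult_le])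

lemma fibre_poly_nonzero: "fibre_poly p q w \<noteq> 0"
proof
  assume eq: "fibre_poly p q w = 0"
  have unit: "degree P = 0" if "is_unit P" for P :: "complex poly"
    using dvd_imp_degree_le[OF that] by simp
  have "degree p = 0 \<and> degree q = 0"
  proof (cases w)
    case (Fin c)
    with eq have p: "p = smult c q" by simp
    with coprime have "is_unit q"
      by (metis dvd_refl dvd_smult coprime_common_divisor)
    then show ?thesis using p unit by simp
  next
    case Infty
    with eq coprime show ?thesis by (simp add: unit)
  qed
  then show False
    using nonconstant degree_eq by simp
qed

lemma ratmap_Fin_eq_iff: "ratmap p q (Fin z) = w \<longleftrightarrow> poly (fibre_poly p q w) z = 0"
  using no_common_root[of z] by (cases w) (auto simp: field_simps)

lemma coeff_top_nonzero: "coeff p d \<noteq> 0 \<or> coeff q d \<noteq> 0"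
  using nonconstant degree_eq by (metis coeff_0_degree_minus_1 leading_coeff_0_iff degree_0 max_def less_numeral_extra(3))

lemma ratmap_Infty_eq_iff: "ratmap p q Infty = w \<longleftrightarrow> coeff (fibre_poly p q w) d = 0"
  using coeff_top_nonzero unfolding degree_eq
  by (cases w) (auto simp: field_simps Let_def)

lemma local_degree_Fin:
  "local_degree (ratmap p q) (Fin a) = order a (fibre_poly p q (ratmap p q (Fin a)))"
proof -
  define w where "w = ratmap p q (Fin a)"
  \<comment> \<open>In the chart at the value \<open>w\<close> the map reads \<open>p / q - c = (p - c q) / q\<close> if \<open>w = Fin c\<close>, and \<open>q / p\<close>
    if \<open>w\<close> is infinite.  Both have the fibre polynomial as numerator, over \<open>D\<close>.\<close>
  define D where "D = (if w = Infty then p else q)"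
  let ?P = "fibre_poly p q w"
  have Da: "poly D a \<noteq> 0"
    using no_common_root[of a] by (auto simp: D_def w_def)
  obtain R where R: "?P = [:- a, 1:] ^ order a ?P * R" "\<not> [:- a, 1:] dvd R"
    using order_decomp[OF fibre_poly_nonzero] by blast
  have Ra: "poly R a \<noteq> 0" using R(2) by (simp add: poly_eq_0_iff_dvd)
  have ev: "\<forall>\<^sub>F t in at 0. chart w (ratmap p q (Fin (a + t))) = poly ?P (a + t) / poly D (a + t)"
  proof (cases w)
    case (Fin c)
    have "((\<lambda>t. poly q (a + t)) \<longlongrightarrow> poly q (a + 0)) (at 0)"
      by (intro tendsto_intros)
    then have "\<forall>\<^sub>F t in at 0. poly q (a + t) \<noteq> 0"
      using Da Fin by (intro tendsto_imp_eventually_ne[where c = "poly q a"]) (auto simp: D_def)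
    then show ?thesis
      by eventually_elim (auto simp: Fin D_def field_simps)
  next
    case Infty
    then have "q \<noteq> 0" using fibre_poly_nonzero[of w] by simp
    then have "finite {z. poly q z = 0}" by (rule poly_roots_finite)
    then have "\<forall>\<^sub>F z in at a. z \<notin> {z. poly q z = 0}"
      using islimpt_finite islimpt_iff_eventually by blast
    then have "\<forall>\<^sub>F t in at 0. poly q (a + t) \<noteq> 0"
      by (subst (asm) at_to_0) (simp add: eventually_filtermap add.commute)
    then show ?thesis
      by eventually_elim (auto simp: Infty D_def)
  qed
  have "zorder (\<lambda>t. chart w (ratmap p q (Fin (a + t)))) 0 = int (order a ?P)"
  proof (rule zorder_quotient_of_polys)
    show "\<forall>\<^sub>F t in at 0. chart w (ratmap p q (Fin (a + t)))
        = t ^ order a ?P * poly (R \<circ>\<^sub>p [:a, 1:]) t / poly (D \<circ>\<^sub>p [:a, 1:]) t"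
      using ev
    proof eventually_elim
      case (elim t)
      have "poly ?P (a + t) = t ^ order a ?P * poly R (a + t)"
        by (subst R(1)) simp
      then show ?case unfolding elim by (simp add: poly_pcompose)
    qed
  qed (use Da Ra in \<open>auto simp: poly_pcompose\<close>)
  then show ?thesis by (simp add: local_degree_def w_def)
qed

lemma local_degree_Infty:
  "local_degree (ratmap p q) Infty = d - degree (fibre_poly p q (ratmap p q Infty))"
proof -
  define w where "w = ratmap p q Infty"
  define D where "D = (if w = Infty then p else q)"
  let ?P = "fibre_poly p q w"
  have Dd: "coeff D d \<noteq> 0"
    using coeff_top_nonzero by (auto simp: D_def w_def degree_eq Let_def split: if_splits)
  then have "degree D = d"
    by (metis D_def degree_eq le_degree max.cobounded1 max.cobounded2 le_antisym)
  \<comment> \<open>With numerator and denominator rewritten by their reflections, which do not vanish at \<open>0\<close>, the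
    difference of the degrees becomes the order of vanishing.\<close>
  have rev: "poly P (1 / t) = poly (reflect_poly P) t / t ^ degree P" if "t \<noteq> 0" for P and t :: complex
    using that poly_reflect_poly_nz[of "1 / t" P] poly_reflect_poly_nz[of t P]
    by (simp add: field_simps)
  have ev: "\<forall>\<^sub>F t in at 0. chart w (ratmap p q (param Infty t)) = poly ?P (1 / t) / poly D (1 / t)"
  proof -
    have "q \<noteq> 0" using fibre_poly_nonzero[of Infty] by simp
    then have "poly (reflect_poly q) 0 \<noteq> 0" by simp
    moreover have "(poly (reflect_poly q) \<longlongrightarrow> poly (reflect_poly q) 0) (at 0)"
      by (intro tendsto_intros)
    ultimately have "\<forall>\<^sub>F t in at 0. poly (reflect_poly q) t \<noteq> 0"
      by (intro tendsto_imp_eventually_ne)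
    then show ?thesis
      using eventually_neq_at_within[of 0 0]
    proof eventually_elim
      case (elim t)
      then have "poly q (1 / t) \<noteq> 0" by (simp add: rev)
      then show ?case
        using \<open>t \<noteq> 0\<close> by (cases w) (auto simp: D_def field_simps)
    qed
  qed
  have "zorder (\<lambda>t. chart w (ratmap p q (param Infty t))) 0 = int (d - degree ?P)"
  proof (rule zorder_quotient_of_polys)
    show "\<forall>\<^sub>F t in at 0. chart w (ratmap p q (param Infty t))
        = t ^ (d - degree ?P) * poly (reflect_poly ?P) t / poly (reflect_poly D) t"
      using ev eventually_neq_at_within[of 0 0]
    proof eventually_elim
      case (elim t)
      have "t ^ d = t ^ (d - degree ?P) * t ^ degree ?P"
        using degree_fibre_poly_le[of w] by (simp flip: power_add)
      then show ?case
        using elim by (simp add: rev \<open>degree D = d\<close>)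
    qed
  qed (use Dd fibre_poly_nonzero[of w] in auto)
  then show ?thesis by (simp add: local_degree_def w_def)
qed

lemma finite_fibre: "finite (ratmap p q -` {w})"
proof (rule finite_subset)
  show "ratmap p q -` {w} \<subseteq> insert Infty (Fin ` {z. poly (fibre_poly p q w) z = 0})"
  proof
    fix x assume "x \<in> ratmap p q -` {w}"
    then show "x \<in> insert Infty (Fin ` {z. poly (fibre_poly p q w) z = 0})"
      using ratmap_Fin_eq_iff[of _ w] by (cases x) auto
  qed
qed (use poly_roots_finite[OF fibre_poly_nonzero] in auto)

lemma in_fibre_partition_iff:
  "m \<in># fibre_partition (ratmap p q) w \<longleftrightarrow>
     (\<exists>z. poly (fibre_poly p q w) z = 0 \<and> m = order z (fibre_poly p q w)) \<or>
     coeff (fibre_poly p q w) d = 0 \<and> m = d - degree (fibre_poly p q w)"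
proof -
  have ex: "(\<exists>x. Q x) \<longleftrightarrow> (\<exists>z. Q (Fin z)) \<or> Q Infty" for Q
    by (metis riemann_sphere.exhaust)
  have "m \<in># fibre_partition (ratmap p q) w \<longleftrightarrow>
      (\<exists>x. ratmap p q x = w \<and> m = local_degree (ratmap p q) x)"
    using finite_fibre[of w] by (auto simp: fibre_partition_def)
  also have "\<dots> \<longleftrightarrow> (\<exists>z. ratmap p q (Fin z) = w \<and> m = order z (fibre_poly p q w)) \<or>
      ratmap p q Infty = w \<and> m = d - degree (fibre_poly p q w)"
    unfolding ex local_degree_Fin local_degree_Infty by blast
  finally show ?thesis unfolding ratmap_Fin_eq_iff ratmap_Infty_eq_iff .
qed

text \<open>
  The heart of the argument: \<open>v\<close> and \<open>w\<close> provide the two powers \<open>G ^ r\<close> and \<open>H ^ r\<close>, and the cofactor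
  lemma confines each zero of the fibre polynomial of \<open>u\<close> to a single factor \<open>G - c H\<close>.
\<close>
lemma local_degrees_le_of_two_divisible_fibres:
  assumes d: "d = r * k" and r: "0 < r"
    and uvw: "u \<noteq> v" "u \<noteq> w" "v \<noteq> w"
    and v: "\<And>m. m \<in># fibre_partition (ratmap p q) v \<Longrightarrow> r dvd m"
    and w: "\<And>m. m \<in># fibre_partition (ratmap p q) w \<Longrightarrow> r dvd m"
    and m: "m \<in># fibre_partition (ratmap p q) u"
  shows "m \<le> k"
proof -
  define Pu where "Pu = fibre_poly p q u"
  obtain a G where a: "a \<noteq> 0" and G: "fibre_poly p q v = smult a (G ^ r)"
    using power_factor_if_root_orders_divisible[OF fibre_poly_nonzero] v in_fibre_partition_iff
    by metis
  obtain b H where b: "b \<noteq> 0" and H: "fibre_poly p q w = smult b (H ^ r)"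
    using power_factor_if_root_orders_divisible[OF fibre_poly_nonzero] w in_fibre_partition_iff
    by metis
  have deg: "degree G \<le> k" "degree H \<le> k"
    using degree_fibre_poly_le[of v] degree_fibre_poly_le[of w] a b r
      fibre_poly_nonzero[of v] fibre_poly_nonzero[of w]
    by (simp_all add: G H d degree_power_eq)
  obtain s t where s: "s \<noteq> 0" and t: "t \<noteq> 0" and
    "Pu = smult s (G ^ r) + smult t (H ^ r)"
  proof -
    obtain s t where "s \<noteq> 0" "t \<noteq> 0"
      "fibre_poly p q u = smult s (fibre_poly p q v) + smult t (fibre_poly p q w)"
      using fibre_poly_combination[OF uvw] .
    then show thesis using that[of "s * a" "t * b"] a b by (simp add: Pu_def G H)
  qed
  note Pu = this(3)
  \<comment> \<open>Here \<open>(g, h)\<close> stands for the value of \<open>(G, H)\<close> at a zero of \<open>Pu\<close>, either a finite one or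
    infinity.\<close>
  have factor: "\<exists>c Q. c * h = g \<and> Pu = smult s ((G - smult c H) * Q) \<and>
      (\<forall>z. poly G z = poly (smult c H) z \<longrightarrow> poly Q z = of_nat r * poly G z ^ (r - 1)) \<and>
      (coeff G k = coeff (smult c H) k \<longrightarrow> coeff Q ((r - 1) * k) = of_nat r * coeff G k ^ (r - 1))"
    if gh: "s * g ^ r + t * h ^ r = 0" "h \<noteq> 0" for g h
  proof -
    define c where "c = g / h"
    have "s * c ^ r = - t"
      using gh by (simp add: c_def power_divide field_simps add_eq_0_iff)
    then have "Pu = smult s (G ^ r - (smult c H) ^ r)"
      by (simp add: Pu smult_power smult_diff_right)
    moreover have "degree (smult c H) \<le> k"
      using deg(2) degree_smult_le order.trans by blast
    ultimately show ?thesis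
      using diff_powers_cofactor[OF deg(1) _ r, of "smult c H"] gh(2)
      by (metis c_def nonzero_eq_divide_eq)
  qed
  consider (finite) z where "poly Pu z = 0" "m = order z Pu"
    | (infinite) "coeff Pu d = 0" "m = d - degree Pu"
    using m unfolding in_fibre_partition_iff Pu_def by blast
  then show ?thesis
  proof cases
    case finite
    \<comment> \<open>The point \<open>z\<close> is mapped to \<open>u\<close>, hence not to \<open>w\<close>.\<close>
    have "poly (fibre_poly p q w) z \<noteq> 0"
      using finite(1) uvw by (metis Pu_def ratmap_Fin_eq_iff)
    then have h: "poly H z \<noteq> 0" using r by (simp add: H)
    have "s * poly G z ^ r + t * poly H z ^ r = 0"
      using finite(1) by (simp add: Pu)
    from factor[OF this h] obtain c Q where c: "c * poly H z = poly G z"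
      and PuQ: "Pu = smult s ((G - smult c H) * Q)"
      and Q: "poly Q z = of_nat r * poly G z ^ (r - 1)"
      by force
    have "poly G z \<noteq> 0"
    proof
      assume "poly G z = 0"
      then show False using finite(1) h t r by (simp add: Pu zero_power)
    qed
    then have "poly Q z \<noteq> 0" using r by (simp add: Q)
    then have "order z Q = 0" by (simp add: order_0I)
    moreover have "(G - smult c H) * Q \<noteq> 0"
      using fibre_poly_nonzero[of u] PuQ by (auto simp: Pu_def)
    ultimately have "order z Pu = order z (G - smult c H)" "G - smult c H \<noteq> 0"
      using s by (auto simp: PuQ order_smult order_mult)
    then have "m \<le> degree (G - smult c H)"
      using finite(2) order_degree by metis
    also have "\<dots> \<le> k"
      using deg by (intro degree_diff_le order.trans[OF degree_smult_le])
    finally show ?thesis .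
  next
    case infinite
    have top: "coeff (G ^ r) d = coeff G k ^ r" "coeff (H ^ r) d = coeff H k ^ r"
      using deg by (simp_all add: d coeff_power_degree_bound)
    have "coeff (fibre_poly p q w) d \<noteq> 0"
      using infinite(1) uvw by (metis Pu_def ratmap_Infty_eq_iff)
    then have h: "coeff H k \<noteq> 0" using r by (simp add: H top)
    have 0: "s * coeff G k ^ r + t * coeff H k ^ r = 0"
      using infinite(1) by (simp add: Pu top)
    from factor[OF this h] obtain c Q where PuQ: "Pu = smult s ((G - smult c H) * Q)"
      and Q: "coeff Q ((r - 1) * k) = of_nat r * coeff G k ^ (r - 1)"
      by force
    have "coeff G k \<noteq> 0"
      using 0 h t r by (auto simp: zero_power)
    \<comment> \<open>The cofactor \<open>Q\<close>, a form of degree \<open>d - k\<close>, has no zero at infinity.  The defect of \<open>Pu\<close> is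
      therefore that of \<open>G - c H\<close>, a form of degree \<open>k\<close>.\<close>
    then have "coeff Q ((r - 1) * k) \<noteq> 0" unfolding Q using r by simp
    then have "(r - 1) * k \<le> degree Q" by (rule le_degree)
    also have "\<dots> \<le> degree Pu"
    proof -
      have "Pu \<noteq> 0" unfolding Pu_def by (rule fibre_poly_nonzero)
      then have "Q dvd Pu" "Pu \<noteq> 0" by (simp_all add: PuQ dvd_smult)
      then show ?thesis by (rule dvd_imp_degree_le)
    qed
    finally have "(r - 1) * k \<le> degree Pu" .
    moreover have "r * k = (r - 1) * k + k"
      using r by (cases r) auto
    ultimately show ?thesis using infinite(2) d by linarith
  qed
qed

end

section \<open>Branching data with two divisible fibres\<close>

lemma image_mset_set_eq_three:
  assumes "image_mset F (mset_set B) = {#a, b, c#}"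
  obtains u v w where "u \<noteq> v" "u \<noteq> w" "v \<noteq> w" "F u = a" "F v = b" "F w = c"
proof -
  obtain u M where u: "mset_set B = add_mset u M" "F u = a" "image_mset F M = {#b, c#}"
    using msed_map_invR[OF assms] by blast
  obtain v N where v: "M = add_mset v N" "F v = b" "image_mset F N = {#c#}"
    using msed_map_invR[OF u(3)] by blast
  obtain w where w: "N = {#w#}" "F w = c"
    using msed_map_invR[OF v(3)] by auto
  have "mset_set B = {#u, v, w#}" using u v w by simp
  moreover have "count (mset_set B) x \<le> 1" for x
    by (simp add: count_mset_set')
  ultimately have le: "count {#u, v, w#} x \<le> 1" for x by metis
  have "u \<noteq> v" "u \<noteq> w" "v \<noteq> w"
    using le[of u] le[of v] by (auto simp: count_single split: if_splits)
  then show thesis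
    using that u(2) v(2) w(2) by blast
qed

theorem corollary1p1:
  fixes r k d :: nat
    and f :: "riemann_sphere \<Rightarrow> riemann_sphere"
    and \<alpha> x y :: "nat multiset"
  assumes "r \<ge> 2" and "k \<ge> 2" and "d = r * k"
    and "rational_map_of_degree f d"
    and "card (branching_points d f) = 3"
    and "branching_datum d f =
           {# \<alpha>, image_mset (\<lambda>a. r * a) x, image_mset (\<lambda>a. r * a) y #}"
    and "\<forall>a \<in># \<alpha>. a > 0" and "\<forall>a \<in># x. a > 0" and "\<forall>a \<in># y. a > 0"
  shows "\<forall>a \<in># \<alpha>. a \<le> k"
proof
  fix a assume a: "a \<in># \<alpha>"
  obtain p q where pq: "coprime p q" "f = ratmap p q" "d = max (degree p) (degree q)"
    using assms(4) unfolding rational_map_of_degree_def by blast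
  interpret nonconstant_ratmap p q d
  proof
    show "0 < d" using assms(1-3) by simp
  qed (use pq in auto)
  obtain u v w where uvw: "u \<noteq> v" "u \<noteq> w" "v \<noteq> w" and "fibre_partition f u = \<alpha>"
    "fibre_partition f v = image_mset (\<lambda>a. r * a) x"
    "fibre_partition f w = image_mset (\<lambda>a. r * a) y"
    using image_mset_set_eq_three[OF assms(6)[unfolded branching_datum_def]] .
  then show "a \<le> k"
    using a assms(1) by (intro local_degrees_le_of_two_divisible_fibres[OF assms(3) _ uvw])
      (auto simp: pq(2))
qed

end
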